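(* Let $G$ be a finite group and let $\mathcal{H}=\{H_i\in V(G)\colon 1\leq i\leq s\}$, with $s\geq 1$, be a set having the property that for any $K\in V(G)$ there exists $H_i\in\mathcal{H}$ such that $[G/K][G/H_i]\neq k[G/1]$ in the Burnside ring $B(G)$ for every positive integer $k$. Then $$\gamma(G)\leq\sum_{i=1}^s |G:N_G(H_i)|.$$ Moreover, $\gamma(G)=1$ if and only if there exists a proper non-trivial normal subgroup $H$ of $G$ such that for every $K\in V(G)$ one has $[G/K][G/H]\neq k[G/1]$ for every positive integer $k$.
   Context: For a group $G$, $V(G)$ denotes the set of all proper non-trivial subgroups of $G$. The intersection graph $\Gamma(G)$ is the simple undirected graph with vertex set $V(G)$ in which two distinct vertices $H,K$ are adjacent if and only if $H\cap K\neq 1$. A dominating set of a graph is a subset $D$ of its vertex set such that every vertex not in $D$ is adjacent to some vertex in $D$. The domination number $\gamma(G)$ is the smallest cardinality of a dominating set of $\Gamma(G)$; by convention $\gamma(G)=\aleph_0$ when $V(G)$ is empty (that is, when $G$ is trivial or cyclic of prime order). The Burnside ring $B(G)$ is the ring generated by isomorphism classes of finite $G$-sets, with addition given by disjoint union and multiplication by Cartesian product (diagonal action); $[G/H]$ is the class of the transitive $G$-set $G/H$. $N_G(H)$ is the normalizer of $H$ in $G$. *)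

theory Defs
  imports "HOL-Library.Extended_Nat" "Graph_Theory.Pair_Digraph"
    "HOL-Algebra.Group_Action" "HOL-Algebra.Left_Coset" "HOL-Algebra.Ring"
begin

section \<open>The intersection graph and its domination number\<close>

definition proper_nontrivial_subgroups :: "('a, 'b) monoid_scheme \<Rightarrow> 'a set set" where
  "proper_nontrivial_subgroups G = {H. subgroup H G \<and> H \<noteq> {\<one>\<^bsub>G\<^esub>} \<and> H \<noteq> carrier G}"

text \<open>A simple undirected graph is a digraph with a symmetric and irreflexive arc relation.\<close>

definition intersection_graph :: "('a, 'b) monoid_scheme \<Rightarrow> 'a set pair_pre_digraph" where
  "intersection_graph G =
     \<lparr> pverts = proper_nontrivial_subgroups G,
       parcs = {(H, K). H \<in> proper_nontrivial_subgroups G \<and> K \<in> proper_nontrivial_subgroups G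
                        \<and> H \<noteq> K \<and> H \<inter> K \<noteq> {\<one>\<^bsub>G\<^esub>}} \<rparr>"

definition dominating_set :: "'v pair_pre_digraph \<Rightarrow> 'v set \<Rightarrow> bool" where
  "dominating_set \<Gamma> D \<longleftrightarrow>
     D \<subseteq> pverts \<Gamma> \<and> (\<forall>v \<in> pverts \<Gamma> - D. \<exists>d \<in> D. (v, d) \<in> parcs \<Gamma>)"

text \<open>All infinite cardinalities are identified with \<open>\<infinity>\<close>; in particular \<open>\<infinity>\<close> represents
  \<open>\<aleph>\<^sub>0\<close> in the convention for groups whose intersection graph has no vertices.\<close>

definition ecard :: "'v set \<Rightarrow> enat" where
  "ecard D = (if finite D then enat (card D) else \<infinity>)"

definition domination_number :: "('a, 'b) monoid_scheme \<Rightarrow> enat" where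
  "domination_number G =
     (if proper_nontrivial_subgroups G = {} then \<infinity>
      else INF D \<in> {D. dominating_set (intersection_graph G) D}. ecard D)"


section \<open>Finite \<open>G\<close>-sets\<close>

type_synonym ('a, 'x) gset = "'x set \<times> ('a \<Rightarrow> 'x \<Rightarrow> 'x)"

definition finite_gset :: "('a, 'b) monoid_scheme \<Rightarrow> ('a, 'x) gset \<Rightarrow> bool" where
  "finite_gset G X \<longleftrightarrow> finite (fst X) \<and> group_action G (fst X) (snd X)"

definition gset_iso ::
    "('a, 'b) monoid_scheme \<Rightarrow> ('a, 'x) gset \<Rightarrow> ('a, 'y) gset \<Rightarrow> bool" where
  "gset_iso G X Y \<longleftrightarrow>
     (\<exists>f. bij_betw f (fst X) (fst Y) \<and>
          (\<forall>g \<in> carrier G. \<forall>x \<in> fst X. f (snd X g x) = snd Y g (f x)))"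

text \<open>\<^const>\<open>group_action\<close> demands that each group element acts by a map that is
  \<^const>\<open>undefined\<close> off the underlying set, whence the restrictions.\<close>

definition gset_sum :: "('a, 'x) gset \<Rightarrow> ('a, 'y) gset \<Rightarrow> ('a, 'x + 'y) gset" where
  "gset_sum X Y =
     (fst X <+> fst Y, \<lambda>g. restrict (map_sum (snd X g) (snd Y g)) (fst X <+> fst Y))"

definition gset_prod :: "('a, 'x) gset \<Rightarrow> ('a, 'y) gset \<Rightarrow> ('a, 'x \<times> 'y) gset" where
  "gset_prod X Y =
     (fst X \<times> fst Y, \<lambda>g. restrict (map_prod (snd X g) (snd Y g)) (fst X \<times> fst Y))"

definition gset_empty :: "('a, nat) gset" where
  "gset_empty = ({}, \<lambda>g. restrict id {})"

definition gset_point :: "('a, nat) gset" where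
  "gset_point = ({0}, \<lambda>g. restrict id {0})"

definition coset_gset :: "('a, 'b) monoid_scheme \<Rightarrow> 'a set \<Rightarrow> ('a, 'a set) gset" where
  "coset_gset G H = (lcosets\<^bsub>G\<^esub> H, \<lambda>g. \<lambda>C \<in> lcosets\<^bsub>G\<^esub> H. g <#\<^bsub>G\<^esub> C)"


section \<open>The Burnside ring\<close>

text \<open>\<open>B(G)\<close> is the Grothendieck ring of the semiring of isomorphism classes of finite \<open>G\<close>-sets:
  its elements are formal differences \<open>[X] - [Y]\<close>, where \<open>[X] - [Y] = [A] - [B]\<close> iff
  \<open>X \<squnion> B \<squnion> Z \<cong> A \<squnion> Y \<squnion> Z\<close> for some finite \<open>G\<close>-set \<open>Z\<close>. Every finite \<open>G\<close>-set is isomorphic to one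
  whose points are natural numbers, so the element \<open>[X] - [Y]\<close> is represented by the set of all
  pairs \<open>(A, B)\<close> of such \<open>G\<close>-sets with \<open>[X] - [Y] = [A] - [B]\<close>. The points of \<open>X\<close> and \<open>Y\<close>
  themselves may be of any type.\<close>

type_synonym 'a virtual_gset = "(('a, nat) gset \<times> ('a, nat) gset) set"

definition gset_difference ::
    "('a, 'b) monoid_scheme \<Rightarrow> ('a, 'x) gset \<Rightarrow> ('a, 'y) gset \<Rightarrow> 'a virtual_gset" where
  "gset_difference G X Y =
     {(A, B). finite_gset G A \<and> finite_gset G B \<and>
        (\<exists>Z :: ('a, nat) gset. finite_gset G Z \<and>
           gset_iso G (gset_sum (gset_sum X B) Z) (gset_sum (gset_sum A Y) Z))}"

definition burnside_class :: "('a, 'b) monoid_scheme \<Rightarrow> ('a, 'x) gset \<Rightarrow> 'a virtual_gset" where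
  "burnside_class G X = gset_difference G X gset_empty"

definition burnside_ring :: "('a, 'b) monoid_scheme \<Rightarrow> 'a virtual_gset ring" where
  "burnside_ring G =
     \<lparr> carrier = {gset_difference G X Y | (X :: ('a, nat) gset) (Y :: ('a, nat) gset).
                    finite_gset G X \<and> finite_gset G Y},
       mult = (\<lambda>a b. \<Union>(X, Y) \<in> a. \<Union>(X', Y') \<in> b.
                 gset_difference G (gset_sum (gset_prod X X') (gset_prod Y Y'))
                                   (gset_sum (gset_prod X Y') (gset_prod Y X'))),
       one = burnside_class G gset_point,
       zero = burnside_class G gset_empty,
       add = (\<lambda>a b. \<Union>(X, Y) \<in> a. \<Union>(X', Y') \<in> b.
                 gset_difference G (gset_sum X X') (gset_sum Y Y')) \<rparr>"

end

theory Submission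
  imports Defs
begin

text \<open>
  The product \<open>G/K \<times> G/H\<close> is a free \<open>G\<close>-set, that is, a disjoint union of copies of \<open>G/1\<close>, exactly when \<open>K\<close>
  meets every conjugate of \<open>H\<close> trivially, because the point \<open>(aK, bH)\<close> has stabilizer
  \<open>aKa\<inverse> \<inter> bHb\<inverse>\<close>. Hence \<open>[G/K][G/H]\<close> differs from all \<open>k[G/1]\<close>, \<open>k > 0\<close>, iff \<open>K\<close> meets
  some conjugate of \<open>H\<close> non-trivially (\<open>coset_product_multiple_of_regular_iff\<close>).

  This turns both claims into statements about the graph. The hypothesis on the family \<open>H\<^sub>i\<close> says
  that the conjugates of its members form a dominating set, and \<open>H\<^sub>i\<close> has \<open>|G : N\<^sub>G(H\<^sub>i)|\<close>
  conjugates. If a single subgroup \<open>H\<close> dominates, then so does its normal core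
  (\<open>normal_core_of_dominating_subgroup\<close>), and for a normal subgroup the condition on conjugates is
  just \<open>K \<inter> H \<noteq> 1\<close>.

  An equation in the Burnside ring is about equivalence classes of formal differences of \<open>G\<close>-sets.
  It becomes arithmetic through the marks \<open>|X\<^sup>U|\<close>, the numbers of points fixed by all of
  \<open>U \<subseteq> G\<close>. By Burnside's theorem (\<open>equivariant_bij_if_marks_eq\<close>) they determine a finite \<open>G\<close>-set
  up to isomorphism, so an element of the ring is the same thing as its difference of marks
  (\<open>gset_difference_eq_virtual_with_marks\<close>). Marks are additive on disjoint unions and
  multiplicative on products, hence the ring operations act pointwise on them; in particular the
  operations do not depend on the chosen representatives.
\<close>

section \<open>Marks determine a finite action\<close>

text \<open>In contrast to \<^const>\<open>group_action\<close>, the values outside \<open>E\<close> are left open, so that an action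
  on \<open>E\<close> is also one on each invariant subset, by the same map.\<close>

definition acts_on ::
    "('a, 'b) monoid_scheme \<Rightarrow> 'x set \<Rightarrow> ('a \<Rightarrow> 'x \<Rightarrow> 'x) \<Rightarrow> bool" where
  "acts_on G E \<phi> \<longleftrightarrow>
     (\<forall>g \<in> carrier G. \<forall>x \<in> E. \<phi> g x \<in> E) \<and>
     (\<forall>x \<in> E. \<phi> \<one>\<^bsub>G\<^esub> x = x) \<and>
     (\<forall>g \<in> carrier G. \<forall>h \<in> carrier G. \<forall>x \<in> E. \<phi> (g \<otimes>\<^bsub>G\<^esub> h) x = \<phi> g (\<phi> h x))"

definition fixed_points :: "'x set \<Rightarrow> ('a \<Rightarrow> 'x \<Rightarrow> 'x) \<Rightarrow> 'a set \<Rightarrow> 'x set" where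
  "fixed_points E \<phi> U = {x \<in> E. \<forall>u \<in> U. \<phi> u x = x}"

definition equivariant_bij ::
    "('a, 'b) monoid_scheme \<Rightarrow> 'x set \<Rightarrow> ('a \<Rightarrow> 'x \<Rightarrow> 'x) \<Rightarrow> 'y set \<Rightarrow> ('a \<Rightarrow> 'y \<Rightarrow> 'y) \<Rightarrow>
      ('x \<Rightarrow> 'y) \<Rightarrow> bool" where
  "equivariant_bij G E \<phi> F \<psi> f \<longleftrightarrow>
     bij_betw f E F \<and> (\<forall>g \<in> carrier G. \<forall>x \<in> E. f (\<phi> g x) = \<psi> g (f x))"

lemma card_fixed_points_equivariant_bij:
  assumes f: "equivariant_bij G E \<phi> F \<psi> f"
    and closed: "\<forall>g \<in> carrier G. \<forall>x \<in> E. \<phi> g x \<in> E"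
    and U: "U \<subseteq> carrier G"
  shows "card (fixed_points E \<phi> U) = card (fixed_points F \<psi> U)"
proof -
  have inj: "inj_on f E" and img: "f ` E = F"
    using f by (auto simp: equivariant_bij_def bij_betw_def)
  have fixed_iff: "\<phi> u x = x \<longleftrightarrow> \<psi> u (f x) = f x" if "u \<in> U" "x \<in> E" for u x
  proof -
    have "f (\<phi> u x) = \<psi> u (f x)" "\<phi> u x \<in> E"
      using f closed U that by (auto simp: equivariant_bij_def)
    then show ?thesis
      using inj that(2) by (metis inj_on_def)
  qed
  have "f ` fixed_points E \<phi> U = fixed_points F \<psi> U"
    using img fixed_iff by (fastforce simp: fixed_points_def)
  moreover have "inj_on f (fixed_points E \<phi> U)"
    using inj by (rule inj_on_subset) (auto simp: fixed_points_def)
  ultimately show ?thesis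
    by (metis card_image)
qed

lemma (in group) acts_on_inv:
  assumes "acts_on G E \<phi>" "g \<in> carrier G" "x \<in> E"
  shows "\<phi> (inv g) (\<phi> g x) = x" "\<phi> g (\<phi> (inv g) x) = x"
proof -
  have "\<phi> (inv g \<otimes> g) x = \<phi> (inv g) (\<phi> g x)" "\<phi> (g \<otimes> inv g) x = \<phi> g (\<phi> (inv g) x)"
    "\<phi> \<one> x = x"
    using assms inv_closed[OF assms(2)] unfolding acts_on_def by blast+
  then show "\<phi> (inv g) (\<phi> g x) = x" "\<phi> g (\<phi> (inv g) x) = x"
    using assms(2) by simp_all
qed

lemma (in group) acts_on_eq_iff:
  assumes "acts_on G E \<phi>" "g \<in> carrier G" "h \<in> carrier G" "x \<in> E"
  shows "\<phi> g x = \<phi> h x \<longleftrightarrow> inv h \<otimes> g \<in> stabilizer G \<phi> x"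
proof -
  have "\<phi> (inv h \<otimes> g) x = \<phi> (inv h) (\<phi> g x)"
    using assms by (simp add: acts_on_def)
  then show ?thesis
    using assms acts_on_inv[OF assms(1,3)]
    by (auto simp: stabilizer_def) (metis acts_on_def)
qed

lemma (in group) acts_on_orbit:
  assumes "acts_on G E \<phi>" "x \<in> E"
  shows "acts_on G (orbit G \<phi> x) \<phi>" "acts_on G (E - orbit G \<phi> x) \<phi>" "orbit G \<phi> x \<subseteq> E"
    "x \<in> orbit G \<phi> x"
proof -
  note act = assms(1)[unfolded acts_on_def]
  show sub: "orbit G \<phi> x \<subseteq> E"
    using assms by (auto simp: acts_on_def orbit_def)
  show "x \<in> orbit G \<phi> x"
    using act assms(2) by (auto simp: orbit_def intro!: exI[of _ \<one>])
  have closed: "\<phi> g y \<in> orbit G \<phi> x" if g: "g \<in> carrier G" and y: "y \<in> orbit G \<phi> x" for g y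
  proof -
    obtain h where "h \<in> carrier G" "y = \<phi> h x"
      using y by (auto simp: orbit_def)
    then have "\<phi> g y = \<phi> (g \<otimes> h) x"
      using act g assms(2) by auto
    then show ?thesis
      using \<open>h \<in> carrier G\<close> g by (auto simp: orbit_def)
  qed
  then show "acts_on G (orbit G \<phi> x) \<phi>"
    using act sub unfolding acts_on_def by blast
  have "\<phi> g y \<notin> orbit G \<phi> x" if "g \<in> carrier G" "y \<in> E - orbit G \<phi> x" for g y
    using closed[of "inv g" "\<phi> g y"] acts_on_inv(1)[OF assms(1), of g y] that by auto
  then show "acts_on G (E - orbit G \<phi> x) \<phi>"
    using act unfolding acts_on_def by blast
qed

text \<open>Both orbits are copies of \<open>G/S\<close>, where \<open>S\<close> is the common stabilizer.\<close>

lemma (in group) equivariant_bij_orbits: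
  assumes act: "acts_on G E \<phi>" "acts_on G F \<psi>"
    and xy: "x \<in> E" "y \<in> F"
    and stab: "stabilizer G \<phi> x = stabilizer G \<psi> y"
  shows "\<exists>f. equivariant_bij G (orbit G \<phi> x) \<phi> (orbit G \<psi> y) \<psi> f"
proof -
  (* The choice of g does not matter: g is determined up to the common stabilizer. *)
  define f where "f z = \<psi> (SOME g. g \<in> carrier G \<and> \<phi> g x = z) y" for z
  have same: "\<phi> g x = \<phi> h x \<longleftrightarrow> \<psi> g y = \<psi> h y" if "g \<in> carrier G" "h \<in> carrier G" for g h
    using acts_on_eq_iff[OF act(1) that xy(1)] acts_on_eq_iff[OF act(2) that xy(2)] stab by simp
  have f: "f (\<phi> g x) = \<psi> g y" if g: "g \<in> carrier G" for g
  proof -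
    let ?h = "SOME h. h \<in> carrier G \<and> \<phi> h x = \<phi> g x"
    have "?h \<in> carrier G \<and> \<phi> ?h x = \<phi> g x"
      by (rule someI_ex) (use g in auto)
    then show ?thesis
      using same[of ?h g] g by (simp add: f_def)
  qed
  have "inj_on f (orbit G \<phi> x)"
    using f same by (auto simp: inj_on_def orbit_def)
  moreover have "f ` orbit G \<phi> x = orbit G \<psi> y"
    using f by (force simp: orbit_def)
  moreover have "f (\<phi> g z) = \<psi> g (f z)" if g: "g \<in> carrier G" and z: "z \<in> orbit G \<phi> x" for g z
  proof -
    obtain h where h: "h \<in> carrier G" "z = \<phi> h x"
      using z by (auto simp: orbit_def)
    have "\<phi> g z = \<phi> (g \<otimes> h) x" "\<psi> (g \<otimes> h) y = \<psi> g (\<psi> h y)"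
      using act xy h g by (auto simp: acts_on_def)
    then show ?thesis
      using f h g by simp
  qed
  ultimately show ?thesis
    by (auto simp: equivariant_bij_def bij_betw_def)
qed

text \<open>Burnside's theorem on the table of marks. A point \<open>x\<close> with maximal stabilizer is matched
  by a point \<open>y\<close> with the same stabilizer: the equality of marks first yields a \<open>y\<close> fixed by the
  stabilizer of \<open>x\<close>, and then a point of \<open>E\<close> fixed by the stabilizer of \<open>y\<close>, so that maximality
  closes the circle. The two orbits are isomorphic, and what remains after removing
  them still has equal marks.\<close>

theorem (in group) equivariant_bij_if_marks_eq:
  fixes \<phi> :: "'a \<Rightarrow> 'x \<Rightarrow> 'x" and \<psi> :: "'a \<Rightarrow> 'y \<Rightarrow> 'y"
  assumes "finite E" "finite F" "acts_on G E \<phi>" "acts_on G F \<psi>"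
    and "\<forall>U \<subseteq> carrier G. card (fixed_points E \<phi> U) = card (fixed_points F \<psi> U)"
  shows "\<exists>f. equivariant_bij G E \<phi> F \<psi> f"
  using assms
proof (induction E arbitrary: F rule: finite_psubset_induct)
  case (psubset E)
  note finF = psubset.prems(1) and actE = psubset.prems(2) and actF = psubset.prems(3)
    and marks = psubset.prems(4)
  show ?case
  proof (cases "E = {}")
    case True
    then have "card (fixed_points F \<psi> {}) = 0"
      using marks by (auto simp: fixed_points_def)
    then have "F = {}"
      using finF by (auto simp: fixed_points_def)
    then show ?thesis
      using True by (auto simp: equivariant_bij_def bij_betw_def)
  next
    case False
    (* Maximal under inclusion among the stabilizers, which are finitely many as E is finite. *)
    have "finite (stabilizer G \<phi> ` E)" "stabilizer G \<phi> ` E \<noteq> {}"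
      using psubset.hyps False by auto
    then obtain S where "S \<in> stabilizer G \<phi> ` E"
      and S_max: "\<And>T. T \<in> stabilizer G \<phi> ` E \<Longrightarrow> S \<subseteq> T \<Longrightarrow> S = T"
      using finite_has_maximal[of "stabilizer G \<phi> ` E"] by metis
    then obtain x where x: "x \<in> E" and S: "S = stabilizer G \<phi> x"
      by auto
    have S_carrier: "S \<subseteq> carrier G"
      by (auto simp: S stabilizer_def)
    have "x \<in> fixed_points E \<phi> S"
      using x by (auto simp: fixed_points_def S stabilizer_def)
    then have "card (fixed_points E \<phi> S) \<noteq> 0"
      using psubset.hyps by (auto simp: fixed_points_def)
    then have "fixed_points F \<psi> S \<noteq> {}"
      using marks S_carrier by auto
    then obtain y where y: "y \<in> F" and S_le: "S \<subseteq> stabilizer G \<psi> y"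
      using S_carrier by (auto simp: fixed_points_def stabilizer_def)
    let ?T = "stabilizer G \<psi> y"
    have T_carrier: "?T \<subseteq> carrier G"
      by (auto simp: stabilizer_def)
    have "y \<in> fixed_points F \<psi> ?T"
      using y by (auto simp: fixed_points_def stabilizer_def)
    then have "card (fixed_points F \<psi> ?T) \<noteq> 0"
      using finF by (auto simp: fixed_points_def)
    then have "fixed_points E \<phi> ?T \<noteq> {}"
      using marks T_carrier by auto
    then obtain x' where "x' \<in> E" "?T \<subseteq> stabilizer G \<phi> x'"
      using T_carrier by (auto simp: fixed_points_def stabilizer_def)
    then have stab: "stabilizer G \<phi> x = ?T"
      using S_max[of "stabilizer G \<phi> x'"] S_le S by auto
    let ?O = "orbit G \<phi> x" and ?P = "orbit G \<psi> y"
    note O = acts_on_orbit[OF actE x] and P = acts_on_orbit[OF actF y]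
    obtain f where f: "equivariant_bij G ?O \<phi> ?P \<psi> f"
      using equivariant_bij_orbits[OF actE actF x y stab] by auto
    have "card (fixed_points (E - ?O) \<phi> U) = card (fixed_points (F - ?P) \<psi> U)"
      if U: "U \<subseteq> carrier G" for U
    proof -
      have "card (fixed_points ?O \<phi> U) = card (fixed_points ?P \<psi> U)"
        using card_fixed_points_equivariant_bij[OF f _ U] O(1) by (simp add: acts_on_def)
      moreover have "fixed_points (E - ?O) \<phi> U = fixed_points E \<phi> U - fixed_points ?O \<phi> U"
        "fixed_points (F - ?P) \<psi> U = fixed_points F \<psi> U - fixed_points ?P \<psi> U"
        by (auto simp: fixed_points_def)
      moreover have "fixed_points ?O \<phi> U \<subseteq> fixed_points E \<phi> U" "finite (fixed_points ?O \<phi> U)"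
        "fixed_points ?P \<psi> U \<subseteq> fixed_points F \<psi> U" "finite (fixed_points ?P \<psi> U)"
        using O(3) P(3) finite_subset[OF O(3) psubset.hyps] finite_subset[OF P(3) finF]
        by (auto simp: fixed_points_def)
      ultimately show ?thesis
        using marks U by (simp add: card_Diff_subset)
    qed
    moreover have "E - ?O \<subset> E"
      using O(4) x by blast
    ultimately obtain f' where f': "equivariant_bij G (E - ?O) \<phi> (F - ?P) \<psi> f'"
      using psubset.IH[of "E - ?O" "F - ?P"] finF O(2) P(2) by blast
    define h where "h z = (if z \<in> ?O then f z else f' z)" for z
    have "bij_betw h ?O ?P"
      using f by (subst bij_betw_cong[of _ _ f]) (auto simp: h_def equivariant_bij_def)
    moreover have "bij_betw h (E - ?O) (F - ?P)"
      using f' by (subst bij_betw_cong[of _ _ f']) (auto simp: h_def equivariant_bij_def)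
    ultimately have "bij_betw h (?O \<union> (E - ?O)) (?P \<union> (F - ?P))"
      by (rule bij_betw_combine) auto
    then have "bij_betw h E F"
      using O(3) P(3) by (simp add: Un_absorb1)
    moreover have "h (\<phi> g z) = \<psi> g (h z)" if "g \<in> carrier G" "z \<in> E" for g z
    proof (cases "z \<in> ?O")
      case True
      then have "\<phi> g z \<in> ?O"
        using O(1) that by (auto simp: acts_on_def)
      then show ?thesis
        using True f that by (auto simp: h_def equivariant_bij_def)
    next
      case False
      then have "\<phi> g z \<in> E - ?O"
        using O(2) that by (auto simp: acts_on_def)
      then show ?thesis
        using False f' that by (auto simp: h_def equivariant_bij_def)
    qed
    ultimately show ?thesis
      by (auto simp: equivariant_bij_def)
  qed
qed

section \<open>Marks of sums, products and coset spaces\<close>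

abbreviation mark :: "('a, 'x) gset \<Rightarrow> 'a set \<Rightarrow> nat" where
  "mark X U \<equiv> card (fixed_points (fst X) (snd X) U)"

lemma (in group) finite_gset_iff:
  "finite_gset G X \<longleftrightarrow>
     finite (fst X) \<and> acts_on G (fst X) (snd X) \<and>
     (\<forall>g \<in> carrier G. snd X g \<in> extensional (fst X))"
proof
  assume X: "finite_gset G X"
  then interpret group_action G "fst X" "snd X"
    by (simp add: finite_gset_def)
  have "snd X \<one> x = x" if "x \<in> fst X" for x
    using fun_cong[OF id_eq_one, of x] that by simp
  then have "acts_on G (fst X) (snd X)"
    unfolding acts_on_def using composition_rule element_image by blast
  then show "finite (fst X) \<and> acts_on G (fst X) (snd X) \<and>
      (\<forall>g \<in> carrier G. snd X g \<in> extensional (fst X))"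
    using X bij_prop0 by (simp add: finite_gset_def Bij_def)
next
  assume X: "finite (fst X) \<and> acts_on G (fst X) (snd X) \<and>
    (\<forall>g \<in> carrier G. snd X g \<in> extensional (fst X))"
  then have act: "acts_on G (fst X) (snd X)"
    by simp
  then have closed: "snd X g x \<in> fst X" if "g \<in> carrier G" "x \<in> fst X" for g x
    using that by (simp add: acts_on_def)
  have bij: "snd X g \<in> Bij (fst X)" if g: "g \<in> carrier G" for g
  proof -
    have "bij_betw (snd X g) (fst X) (fst X)"
    proof (rule bij_betw_byWitness[where f' = "snd X (inv g)"])
      show "\<forall>x \<in> fst X. snd X (inv g) (snd X g x) = x"
        "\<forall>x \<in> fst X. snd X g (snd X (inv g) x) = x"
        using acts_on_inv[OF act g] by blast+
      show "snd X g ` fst X \<subseteq> fst X" "snd X (inv g) ` fst X \<subseteq> fst X"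
        using closed g by blast+
    qed
    then show ?thesis
      using X g by (simp add: Bij_def)
  qed
  have hom: "snd X (g \<otimes> h) = compose (fst X) (snd X g) (snd X h)"
    if "g \<in> carrier G" "h \<in> carrier G" for g h
  proof (rule extensionalityI[where A = "fst X"])
    show "snd X (g \<otimes> h) x = compose (fst X) (snd X g) (snd X h) x" if "x \<in> fst X" for x
      using act that \<open>g \<in> carrier G\<close> \<open>h \<in> carrier G\<close> by (simp add: acts_on_def compose_def)
  qed (use X that in simp_all)
  have "snd X \<in> hom G (BijGroup (fst X))"
    using bij hom by (simp add: hom_def BijGroup_def)
  then have "group_action G (fst X) (snd X)"
    using group_BijGroup is_group
    by (simp add: group_action_def group_hom_def group_hom_axioms_def)
  then show "finite_gset G X"
    using X by (simp add: finite_gset_def)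
qed

lemma (in group) gset_iso_iff_marks_eq:
  assumes X: "finite_gset G X" and Y: "finite_gset G Y"
  shows "gset_iso G X Y \<longleftrightarrow> (\<forall>U \<subseteq> carrier G. mark X U = mark Y U)"
proof
  assume "gset_iso G X Y"
  then obtain f where "equivariant_bij G (fst X) (snd X) (fst Y) (snd Y) f"
    by (auto simp: gset_iso_def equivariant_bij_def)
  then show "\<forall>U \<subseteq> carrier G. mark X U = mark Y U"
    using X card_fixed_points_equivariant_bij by (auto simp: finite_gset_iff acts_on_def)
next
  assume "\<forall>U \<subseteq> carrier G. mark X U = mark Y U"
  then obtain f where "equivariant_bij G (fst X) (snd X) (fst Y) (snd Y) f"
    using equivariant_bij_if_marks_eq[of "fst X" "fst Y" "snd X" "snd Y"] X Y
    by (auto simp: finite_gset_iff)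
  then show "gset_iso G X Y"
    by (auto simp: gset_iso_def equivariant_bij_def)
qed

lemma (in group) finite_gset_gset_sum:
  assumes "finite_gset G X" "finite_gset G Y"
  shows "finite_gset G (gset_sum X Y)"
  using assms unfolding finite_gset_iff gset_sum_def acts_on_def by auto

lemma (in group) finite_gset_gset_prod:
  assumes "finite_gset G X" "finite_gset G Y"
  shows "finite_gset G (gset_prod X Y)"
  using assms unfolding finite_gset_iff gset_prod_def acts_on_def by auto

lemma (in group) finite_gset_gset_empty: "finite_gset G gset_empty"
  by (auto simp: finite_gset_iff gset_empty_def acts_on_def)

lemma mark_gset_empty [simp]: "mark gset_empty U = 0"
  by (simp add: gset_empty_def fixed_points_def)

lemma mark_gset_sum:
  assumes "finite (fst X)" "finite (fst Y)"
  shows "mark (gset_sum X Y) U = mark X U + mark Y U"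
proof -
  have "fixed_points (fst (gset_sum X Y)) (snd (gset_sum X Y)) U
      = fixed_points (fst X) (snd X) U <+> fixed_points (fst Y) (snd Y) U"
    by (auto simp: fixed_points_def gset_sum_def)
  then show ?thesis
    using assms by (simp add: card_Plus fixed_points_def)
qed

lemma mark_gset_prod: "mark (gset_prod X Y) U = mark X U * mark Y U"
proof -
  have "fixed_points (fst (gset_prod X Y)) (snd (gset_prod X Y)) U
      = fixed_points (fst X) (snd X) U \<times> fixed_points (fst Y) (snd Y) U"
    by (auto simp: fixed_points_def gset_prod_def)
  then show ?thesis
    by (simp add: card_cartesian_product)
qed

text \<open>Elements of the Burnside ring consist of pairs of \<open>G\<close>-sets on natural numbers. This copy of \<open>X\<close>
  shows that they are non-empty, so that their marks can be read off.\<close>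

lemma (in group) ex_nat_gset_same_marks:
  assumes X: "finite_gset G X"
  shows "\<exists>A :: ('a, nat) gset. finite_gset G A \<and> (\<forall>U \<subseteq> carrier G. mark A U = mark X U)"
proof -
  obtain f where f: "bij_betw f (fst X) {0..<card (fst X)}"
    using X ex_bij_betw_finite_nat by (auto simp: finite_gset_iff)
  let ?N = "{0..<card (fst X)}" and ?f' = "inv_into (fst X) f"
  define A :: "('a, nat) gset" where
    "A = (?N, \<lambda>g. restrict (\<lambda>n. f (snd X g (?f' n))) ?N)"
  have f'_f: "?f' (f x) = x" if "x \<in> fst X" for x
    using f that by (simp add: bij_betw_inv_into_left)
  have f_f': "f (?f' n) = n" if "n < card (fst X)" for n
    using f that by (simp add: bij_betw_inv_into_right)
  have f_in: "f x < card (fst X)" if "x \<in> fst X" for x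
    using f that by (auto simp: bij_betw_def)
  have f'_in: "?f' n \<in> fst X" if "n < card (fst X)" for n
    using f that by (auto simp: bij_betw_def intro: inv_into_into)
  note act = X[unfolded finite_gset_iff acts_on_def]
  have A: "finite_gset G A"
    using act f'_f f_f' f_in f'_in by (auto simp: finite_gset_iff acts_on_def A_def)
  have "gset_iso G X A"
    using act f f_in f'_f by (auto simp: gset_iso_def A_def intro!: exI[of _ f])
  then show ?thesis
    using gset_iso_iff_marks_eq[OF X A] A by metis
qed

lemma (in group) finite_gset_coset_gset:
  assumes "finite (carrier G)" "subgroup H G"
  shows "finite_gset G (coset_gset G H)"
proof -
  have H: "H \<subseteq> carrier G"
    using assms(2) by (rule subgroup.subset)
  have C: "g <# C \<in> lcosets H" if "g \<in> carrier G" "C \<in> lcosets H" for g C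
    using that H by (auto simp: LCOSETS_def lcos_m_assoc)
  have sub: "C \<subseteq> carrier G" if "C \<in> lcosets H" for C
    using that H by (auto simp: LCOSETS_def dest: l_coset_subset_G)
  show ?thesis
    using assms(1) C sub
    by (auto simp: finite_gset_iff coset_gset_def acts_on_def lcos_mult_one lcos_m_assoc)
      (auto simp: LCOSETS_def)
qed

lemma (in group) l_coset_fixed_iff:
  assumes H: "subgroup H G" and u: "u \<in> carrier G" and a: "a \<in> carrier G"
  shows "u <# (a <# H) = a <# H \<longleftrightarrow> inv a \<otimes> u \<otimes> a \<in> H"
proof -
  have eq: "u <# (a <# H) = (u \<otimes> a) <# H"
    using lcos_m_assoc[OF subgroup.subset[OF H] u a] .
  have "u \<otimes> a \<in> a <# H \<longleftrightarrow> inv a \<otimes> (u \<otimes> a) \<in> H"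
    using H u a subgroup.lcos_module_imp[OF H group_axioms a]
      subgroup.lcos_module_rev[OF H group_axioms a] by auto
  moreover have "(u \<otimes> a) <# H = a <# H \<longleftrightarrow> u \<otimes> a \<in> a <# H"
    using lcos_self[of "u \<otimes> a" H] l_repr_independence[of "u \<otimes> a" a H] H u a by auto
  ultimately show ?thesis
    using eq u a by (simp add: m_assoc)
qed

lemma (in group) fixed_points_coset_gset:
  assumes "subgroup H G" "U \<subseteq> carrier G"
  shows "fixed_points (fst (coset_gset G H)) (snd (coset_gset G H)) U
    = (\<lambda>a. a <# H) ` {a \<in> carrier G. \<forall>u \<in> U. inv a \<otimes> u \<otimes> a \<in> H}"
proof -
  have "fixed_points (fst (coset_gset G H)) (snd (coset_gset G H)) U
      = {C \<in> lcosets H. \<forall>u \<in> U. u <# C = C}"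
    by (auto simp: fixed_points_def coset_gset_def)
  also have "\<dots> = (\<lambda>a. a <# H) ` {a \<in> carrier G. \<forall>u \<in> U. u <# (a <# H) = a <# H}"
    by (auto simp: LCOSETS_def)
  also have "{a \<in> carrier G. \<forall>u \<in> U. u <# (a <# H) = a <# H}
      = {a \<in> carrier G. \<forall>u \<in> U. inv a \<otimes> u \<otimes> a \<in> H}"
    using l_coset_fixed_iff[OF assms(1)] assms(2) by blast
  finally show ?thesis .
qed

section \<open>The Burnside ring in terms of marks\<close>

text \<open>The element of the Burnside ring with mark function \<open>m\<close>. It is empty if no formal difference has
  these marks.\<close>

definition virtual_with_marks ::
    "('a, 'b) monoid_scheme \<Rightarrow> ('a set \<Rightarrow> int) \<Rightarrow> 'a virtual_gset" where
  "virtual_with_marks G m =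
     {(A, B). finite_gset G A \<and> finite_gset G B \<and>
        (\<forall>U \<subseteq> carrier G. int (mark A U) - int (mark B U) = m U)}"

lemma virtual_with_marks_cong:
  assumes "\<And>U. U \<subseteq> carrier G \<Longrightarrow> m U = n U"
  shows "virtual_with_marks G m = virtual_with_marks G n"
  using assms by (auto simp: virtual_with_marks_def)

lemma virtual_with_marks_eqD:
  assumes "virtual_with_marks G m = virtual_with_marks G n" "virtual_with_marks G m \<noteq> {}"
    and "U \<subseteq> carrier G"
  shows "m U = n U"
proof -
  obtain A B where "(A, B) \<in> virtual_with_marks G m" "(A, B) \<in> virtual_with_marks G n"
    using assms(1,2) by auto
  then have "m U = int (mark A U) - int (mark B U)" "n U = int (mark A U) - int (mark B U)"
    using assms(3) by (auto simp: virtual_with_marks_def)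
  then show ?thesis
    by simp
qed

text \<open>In the equation \<open>X \<squnion> B \<squnion> Z \<cong> A \<squnion> Y \<squnion> Z\<close> the marks of \<open>Z\<close> cancel, so a formal difference
  is known once the difference of marks is known.\<close>

lemma (in group) gset_difference_eq_virtual_with_marks:
  assumes X: "finite_gset G X" and Y: "finite_gset G Y"
  shows "gset_difference G X Y = virtual_with_marks G (\<lambda>U. int (mark X U) - int (mark Y U))"
proof -
  have stable: "(\<exists>Z :: ('a, nat) gset. finite_gset G Z \<and>
        gset_iso G (gset_sum (gset_sum X B) Z) (gset_sum (gset_sum A Y) Z)) \<longleftrightarrow>
      (\<forall>U \<subseteq> carrier G. int (mark A U) - int (mark B U) = int (mark X U) - int (mark Y U))"
    if A: "finite_gset G A" and B: "finite_gset G B" for A B :: "('a, nat) gset"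
  proof -
    have "gset_iso G (gset_sum (gset_sum X B) Z) (gset_sum (gset_sum A Y) Z) \<longleftrightarrow>
        (\<forall>U \<subseteq> carrier G. int (mark A U) - int (mark B U) = int (mark X U) - int (mark Y U))"
      if Z: "finite_gset G Z" for Z :: "('a, nat) gset"
    proof -
      have fin: "finite (fst X)" "finite (fst Y)" "finite (fst A)" "finite (fst B)"
        "finite (fst Z)"
        using X Y A B Z by (auto simp: finite_gset_iff)
      have fin': "finite (fst (gset_sum X B))" "finite (fst (gset_sum A Y))"
        using fin by (auto simp: gset_sum_def)
      have "mark (gset_sum (gset_sum X B) Z) U = mark (gset_sum (gset_sum A Y) Z) U \<longleftrightarrow>
          int (mark A U) - int (mark B U) = int (mark X U) - int (mark Y U)" for U
        using fin fin' by (simp add: mark_gset_sum) linarith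
      then show ?thesis
        using X Y A B Z by (simp add: gset_iso_iff_marks_eq finite_gset_gset_sum)
    qed
    then show ?thesis
      using finite_gset_gset_empty by blast
  qed
  show ?thesis
    unfolding gset_difference_def virtual_with_marks_def using stable by blast
qed

lemma (in group) gset_difference_nonempty:
  assumes "finite_gset G X" "finite_gset G Y"
  shows "gset_difference G X Y \<noteq> {}"
proof -
  obtain A B :: "('a, nat) gset" where "finite_gset G A" "finite_gset G B"
    and "\<forall>U \<subseteq> carrier G. mark A U = mark X U" "\<forall>U \<subseteq> carrier G. mark B U = mark Y U"
    using ex_nat_gset_same_marks assms by meson
  then have "(A, B) \<in> gset_difference G X Y"
    using assms by (simp add: gset_difference_eq_virtual_with_marks virtual_with_marks_def)
  then show ?thesis
    by blast
qed

lemma (in group) gset_difference_eqI: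
  assumes "finite_gset G X" "finite_gset G Y"
    and "\<And>U. U \<subseteq> carrier G \<Longrightarrow> int (mark X U) - int (mark Y U) = m U"
  shows "gset_difference G X Y = virtual_with_marks G m"
proof -
  have "virtual_with_marks G (\<lambda>U. int (mark X U) - int (mark Y U)) = virtual_with_marks G m"
    using assms(3) by (rule virtual_with_marks_cong)
  then show ?thesis
    using gset_difference_eq_virtual_with_marks[OF assms(1,2)] by simp
qed

lemma (in group) burnside_class_eq_virtual_with_marks:
  assumes "finite_gset G X"
  shows "burnside_class G X = virtual_with_marks G (\<lambda>U. int (mark X U))"
  using gset_difference_eq_virtual_with_marks[OF assms finite_gset_gset_empty]
  by (simp add: burnside_class_def)

lemma (in group) burnside_class_nonempty:
  assumes "finite_gset G X"
  shows "burnside_class G X \<noteq> {}"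
  using gset_difference_nonempty[OF assms finite_gset_gset_empty]
  by (simp add: burnside_class_def)

text \<open>Sum and product in the Burnside ring are unions over all pairs of representatives. Once every
  pair is known to contribute the same element, this evaluates the union.\<close>

lemma UN_UN_constant:
  assumes "A \<noteq> {}" "B \<noteq> {}"
    and "\<And>X Y X' Y'. (X, Y) \<in> A \<Longrightarrow> (X', Y') \<in> B \<Longrightarrow> F X Y X' Y' = C"
  shows "(\<Union>(X, Y) \<in> A. \<Union>(X', Y') \<in> B. F X Y X' Y') = C"
proof -
  have "(\<Union>(X', Y') \<in> B. F X Y X' Y') = C" if "(X, Y) \<in> A" for X Y
    by (rule SUP_eq_const) (use assms(2,3) that in auto)
  then show ?thesis
    by (intro SUP_eq_const[OF assms(1)]) clarsimp
qed

lemma (in group) burnside_ring_mult_virtual_with_marks: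
  assumes "virtual_with_marks G m \<noteq> {}" "virtual_with_marks G n \<noteq> {}"
  shows "virtual_with_marks G m \<otimes>\<^bsub>burnside_ring G\<^esub> virtual_with_marks G n
    = virtual_with_marks G (\<lambda>U. m U * n U)"
proof -
  have rep: "gset_difference G (gset_sum (gset_prod X X') (gset_prod Y Y'))
      (gset_sum (gset_prod X Y') (gset_prod Y X')) = virtual_with_marks G (\<lambda>U. m U * n U)"
    if XY: "(X, Y) \<in> virtual_with_marks G m" and XY': "(X', Y') \<in> virtual_with_marks G n"
    for X Y X' Y'
  proof (rule gset_difference_eqI)
    have fin: "finite_gset G X" "finite_gset G Y" "finite_gset G X'" "finite_gset G Y'"
      using XY XY' by (auto simp: virtual_with_marks_def)
    then show "finite_gset G (gset_sum (gset_prod X X') (gset_prod Y Y'))"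
      "finite_gset G (gset_sum (gset_prod X Y') (gset_prod Y X'))"
      by (simp_all add: finite_gset_gset_sum finite_gset_gset_prod)
    have finp: "finite (fst (gset_prod X X'))" "finite (fst (gset_prod Y Y'))"
      "finite (fst (gset_prod X Y'))" "finite (fst (gset_prod Y X'))"
      using fin by (simp_all add: finite_gset_def gset_prod_def)
    fix U assume "U \<subseteq> carrier G"
    then have mn: "m U = int (mark X U) - int (mark Y U)" "n U = int (mark X' U) - int (mark Y' U)"
      using XY XY' by (auto simp: virtual_with_marks_def)
    show "int (mark (gset_sum (gset_prod X X') (gset_prod Y Y')) U)
        - int (mark (gset_sum (gset_prod X Y') (gset_prod Y X')) U) = m U * n U"
      using finp by (simp add: mn mark_gset_sum mark_gset_prod algebra_simps)
  qed
  have "mult (burnside_ring G) a b = (\<Union>(X, Y) \<in> a. \<Union>(X', Y') \<in> b.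
      gset_difference G (gset_sum (gset_prod X X') (gset_prod Y Y'))
        (gset_sum (gset_prod X Y') (gset_prod Y X')))" for a b
    by (simp add: burnside_ring_def)
  then show ?thesis
    using UN_UN_constant[OF assms rep] by simp
qed

lemma (in group) burnside_ring_add_virtual_with_marks:
  assumes "virtual_with_marks G m \<noteq> {}" "virtual_with_marks G n \<noteq> {}"
  shows "virtual_with_marks G m \<oplus>\<^bsub>burnside_ring G\<^esub> virtual_with_marks G n
      = virtual_with_marks G (\<lambda>U. m U + n U)" (is ?sum)
    and "virtual_with_marks G (\<lambda>U. m U + n U) \<noteq> {}" (is ?nonempty)
proof -
  have fin: "finite_gset G (gset_sum X X')" "finite_gset G (gset_sum Y Y')"
    if "(X, Y) \<in> virtual_with_marks G m" "(X', Y') \<in> virtual_with_marks G n" for X Y X' Y'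
    using that by (auto simp: virtual_with_marks_def intro: finite_gset_gset_sum)
  have rep: "gset_difference G (gset_sum X X') (gset_sum Y Y')
      = virtual_with_marks G (\<lambda>U. m U + n U)"
    if XY: "(X, Y) \<in> virtual_with_marks G m" and XY': "(X', Y') \<in> virtual_with_marks G n"
    for X Y X' Y'
  proof (rule gset_difference_eqI[OF fin[OF XY XY']])
    have finite: "finite (fst X)" "finite (fst Y)" "finite (fst X')" "finite (fst Y')"
      using XY XY' by (auto simp: virtual_with_marks_def finite_gset_def)
    fix U assume "U \<subseteq> carrier G"
    then have "m U = int (mark X U) - int (mark Y U)" "n U = int (mark X' U) - int (mark Y' U)"
      using XY XY' by (auto simp: virtual_with_marks_def)
    then show "int (mark (gset_sum X X') U) - int (mark (gset_sum Y Y') U) = m U + n U"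
      using finite by (simp add: mark_gset_sum)
  qed
  have "add (burnside_ring G) a b = (\<Union>(X, Y) \<in> a. \<Union>(X', Y') \<in> b.
      gset_difference G (gset_sum X X') (gset_sum Y Y'))" for a b
    by (simp add: burnside_ring_def)
  then show ?sum
    using UN_UN_constant[OF assms rep] by simp
  obtain p q where "p \<in> virtual_with_marks G m" "q \<in> virtual_with_marks G n"
    using assms by blast
  then have pq: "(fst p, snd p) \<in> virtual_with_marks G m" "(fst q, snd q) \<in> virtual_with_marks G n"
    by simp_all
  show ?nonempty
    using gset_difference_nonempty[OF fin[OF pq]] unfolding rep[OF pq] .
qed

lemma (in group) burnside_ring_multiple_virtual_with_marks:
  assumes "virtual_with_marks G m \<noteq> {}"
  shows "[k] \<cdot>\<^bsub>burnside_ring G\<^esub> virtual_with_marks G m = virtual_with_marks G (\<lambda>U. int k * m U)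
    \<and> virtual_with_marks G (\<lambda>U. int k * m U) \<noteq> {}"
proof (induction k)
  case 0
  have "[(0 :: nat)] \<cdot>\<^bsub>burnside_ring G\<^esub> virtual_with_marks G m = burnside_class G gset_empty"
    by (simp add: add_pow_def nat_pow_def burnside_ring_def)
  then show ?case
    using burnside_class_eq_virtual_with_marks[OF finite_gset_gset_empty]
      burnside_class_nonempty[OF finite_gset_gset_empty] by simp
next
  case (Suc k)
  have "[Suc k] \<cdot>\<^bsub>burnside_ring G\<^esub> virtual_with_marks G m
      = ([k] \<cdot>\<^bsub>burnside_ring G\<^esub> virtual_with_marks G m) \<oplus>\<^bsub>burnside_ring G\<^esub> virtual_with_marks G m"
    by (simp add: add_pow_def nat_pow_def)
  then show ?case
    using Suc assms burnside_ring_add_virtual_with_marks[of "\<lambda>U. int k * m U" m]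
    by (simp add: algebra_simps)
qed

lemma (in group) burnside_product_eq_multiple_iff:
  assumes X: "finite_gset G X" and Y: "finite_gset G Y" and Z: "finite_gset G Z"
  shows "burnside_class G X \<otimes>\<^bsub>burnside_ring G\<^esub> burnside_class G Y
      = [k] \<cdot>\<^bsub>burnside_ring G\<^esub> burnside_class G Z \<longleftrightarrow>
    (\<forall>U \<subseteq> carrier G. mark X U * mark Y U = k * mark Z U)"
proof -
  let ?V = "virtual_with_marks G"
  have ne: "?V (\<lambda>U. int (mark X U)) \<noteq> {}" "?V (\<lambda>U. int (mark Y U)) \<noteq> {}"
    "?V (\<lambda>U. int (mark Z U)) \<noteq> {}"
    using burnside_class_nonempty burnside_class_eq_virtual_with_marks X Y Z by metis+
  have mult: "burnside_class G X \<otimes>\<^bsub>burnside_ring G\<^esub> burnside_class G Y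
      = ?V (\<lambda>U. int (mark X U) * int (mark Y U))"
    using ne X Y by (simp add: burnside_class_eq_virtual_with_marks
        burnside_ring_mult_virtual_with_marks)
  have multiple: "[k] \<cdot>\<^bsub>burnside_ring G\<^esub> burnside_class G Z = ?V (\<lambda>U. int k * int (mark Z U))"
    "?V (\<lambda>U. int k * int (mark Z U)) \<noteq> {}"
    using burnside_ring_multiple_virtual_with_marks[OF ne(3), of k] Z
    by (auto simp: burnside_class_eq_virtual_with_marks)
  show ?thesis
  proof
    assume "burnside_class G X \<otimes>\<^bsub>burnside_ring G\<^esub> burnside_class G Y
      = [k] \<cdot>\<^bsub>burnside_ring G\<^esub> burnside_class G Z"
    then have "int (mark X U) * int (mark Y U) = int k * int (mark Z U)"
      if "U \<subseteq> carrier G" for U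
      using virtual_with_marks_eqD[of G "\<lambda>U. int (mark X U) * int (mark Y U)"
          "\<lambda>U. int k * int (mark Z U)"] mult multiple that by simp
    then show "\<forall>U \<subseteq> carrier G. mark X U * mark Y U = k * mark Z U"
      by (simp flip: of_nat_mult)
  next
    assume "\<forall>U \<subseteq> carrier G. mark X U * mark Y U = k * mark Z U"
    then have "?V (\<lambda>U. int (mark X U) * int (mark Y U)) = ?V (\<lambda>U. int k * int (mark Z U))"
      by (intro virtual_with_marks_cong) (simp flip: of_nat_mult)
    then show "burnside_class G X \<otimes>\<^bsub>burnside_ring G\<^esub> burnside_class G Y
      = [k] \<cdot>\<^bsub>burnside_ring G\<^esub> burnside_class G Z"
      using mult multiple by simp
  qed
qed

section \<open>Products of transitive sets that are multiples of the regular one\<close>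

lemma (in group) mem_conjugate_iff:
  assumes "H \<subseteq> carrier G" "g \<in> carrier G"
  shows "x \<in> g <# H #> inv g \<longleftrightarrow> x \<in> carrier G \<and> inv g \<otimes> x \<otimes> g \<in> H"
proof
  assume "x \<in> g <# H #> inv g"
  then obtain h where h: "h \<in> H" "x = g \<otimes> h \<otimes> inv g"
    by (auto simp: l_coset_def r_coset_def)
  then have "inv g \<otimes> x \<otimes> g = h"
    using conjugation_is_surj[of "inv g" h] assms by auto
  then show "x \<in> carrier G \<and> inv g \<otimes> x \<otimes> g \<in> H"
    using h assms by auto
next
  assume x: "x \<in> carrier G \<and> inv g \<otimes> x \<otimes> g \<in> H"
  then have "x = g \<otimes> (inv g \<otimes> x \<otimes> g) \<otimes> inv g"
    using conjugation_is_surj assms(2) by simp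
  then show "x \<in> g <# H #> inv g"
    using x unfolding l_coset_def r_coset_def by blast
qed

lemma (in group) mark_coset_gset_regular:
  assumes "U \<subseteq> carrier G" "u \<in> U" "u \<noteq> \<one>"
  shows "mark (coset_gset G {\<one>}) U = 0"
proof -
  have "inv a \<otimes> u \<otimes> a \<noteq> \<one>" if a: "a \<in> carrier G" for a
    using conjugation_is_surj[OF a, of u] a assms by auto
  then have "{a \<in> carrier G. \<forall>u \<in> U. inv a \<otimes> u \<otimes> a \<in> {\<one>}} = {}"
    using assms(2) by blast
  then have "fixed_points (fst (coset_gset G {\<one>})) (snd (coset_gset G {\<one>})) U = {}"
    using fixed_points_coset_gset[OF triv_subgroup assms(1)] by (simp only: image_empty)
  then show ?thesis
    by simp
qed

text \<open>In the orbit-counting lemma only the identity contributes.\<close>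

lemma (in group_action) card_free_action:
  assumes "finite (carrier G)" "finite E"
    and free: "\<And>g. g \<in> carrier G \<Longrightarrow> g \<noteq> \<one> \<Longrightarrow> fixed_points E \<phi> {g} = {}"
  shows "card E = card (orbits G E \<phi>) * order G"
proof -
  interpret group G
    using group_hom by (rule group_hom.axioms(1))
  have "invariants E \<phi> g = (if g = \<one> then E else {})" if "g \<in> carrier G" for g
    using free[OF that] id_eq_one[symmetric] by (auto simp: invariants_def fixed_points_def)
  then have "(\<Sum>g \<in> carrier G. card (invariants E \<phi> g))
      = (\<Sum>g \<in> carrier G. if g = \<one> then card E else 0)"
    by (intro sum.cong) auto
  then show ?thesis
    using burnside[OF assms(1,2)] assms(1) by simp
qed

text \<open>A point \<open>(aK, bH)\<close> has stabilizer \<open>aKa\<inverse> \<inter> bHb\<inverse>\<close>. If \<open>K\<close> meets every conjugate of \<open>H\<close>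
  trivially, the product is therefore a free \<open>G\<close>-set and \<open>k\<close> is its number of orbits. Otherwise
  some non-identity element has a fixed point in the product, but it has none in any
  multiple of \<open>G/1\<close>.\<close>

theorem (in group) coset_product_multiple_of_regular_iff:
  assumes fin: "finite (carrier G)" and K: "subgroup K G" and H: "subgroup H G"
  shows "(\<exists>k :: nat. k > 0 \<and>
      burnside_class G (coset_gset G K) \<otimes>\<^bsub>burnside_ring G\<^esub> burnside_class G (coset_gset G H)
        = [k] \<cdot>\<^bsub>burnside_ring G\<^esub> burnside_class G (coset_gset G {\<one>})) \<longleftrightarrow>
    (\<forall>g \<in> carrier G. K \<inter> (g <# H #> inv g) = {\<one>})"
    (is "?L \<longleftrightarrow> ?R")
proof -
  let ?X = "coset_gset G K" and ?Y = "coset_gset G H" and ?Z = "coset_gset G {\<one>}"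
  let ?P = "gset_prod ?X ?Y"
  have gsets: "finite_gset G ?X" "finite_gset G ?Y" "finite_gset G ?Z"
    using finite_gset_coset_gset fin K H triv_subgroup by auto
  have L: "?L \<longleftrightarrow> (\<exists>k. k > 0 \<and> (\<forall>U \<subseteq> carrier G. mark ?P U = k * mark ?Z U))"
    using burnside_product_eq_multiple_iff[OF gsets] by (simp add: mark_gset_prod)
  have H_sub: "H \<subseteq> carrier G"
    using H by (rule subgroup.subset)
  show ?thesis
  proof
    assume ?L
    then obtain k where k: "\<And>U. U \<subseteq> carrier G \<Longrightarrow> mark ?P U = k * mark ?Z U"
      using L by auto
    show ?R
    proof (intro ballI equalityI subsetI)
      fix g x assume g: "g \<in> carrier G" and x: "x \<in> K \<inter> (g <# H #> inv g)"
      then have xG: "x \<in> carrier G" and conj: "inv g \<otimes> x \<otimes> g \<in> H"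
        using mem_conjugate_iff[OF H_sub g] by auto
      have "\<one> <# K \<in> fixed_points (fst ?X) (snd ?X) {x}"
        using x xG by (auto simp: fixed_points_coset_gset[OF K])
      moreover have "g <# H \<in> fixed_points (fst ?Y) (snd ?Y) {x}"
        using conj g xG by (auto simp: fixed_points_coset_gset[OF H])
      ultimately have "mark ?X {x} \<noteq> 0" "mark ?Y {x} \<noteq> 0"
        using gsets by (auto simp: fixed_points_def finite_gset_def)
      then have "mark ?P {x} \<noteq> 0"
        by (simp add: mark_gset_prod)
      then have "mark ?Z {x} \<noteq> 0"
        using k[of "{x}"] xG by simp
      then show "x \<in> {\<one>}"
        using mark_coset_gset_regular[of "{x}" x] xG by auto
    next
      fix g x assume g: "g \<in> carrier G" and x: "x \<in> {\<one>}"
      then show "x \<in> K \<inter> (g <# H #> inv g)"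
        using K H by (simp add: mem_conjugate_iff[OF H_sub g] subgroup.one_closed)
    qed
  next
    assume R: ?R
    have no_fixed: "mark ?P U = 0" if U: "U \<subseteq> carrier G" "u \<in> U" "u \<noteq> \<one>" for U u
    proof (rule ccontr)
      assume "mark ?P U \<noteq> 0"
      then have "fixed_points (fst ?X) (snd ?X) U \<noteq> {}" "fixed_points (fst ?Y) (snd ?Y) U \<noteq> {}"
        by (auto simp: mark_gset_prod)
      then obtain a b where a: "a \<in> carrier G" "inv a \<otimes> u \<otimes> a \<in> K"
        and b: "b \<in> carrier G" "inv b \<otimes> u \<otimes> b \<in> H"
        using U(2) by (auto simp: fixed_points_coset_gset[OF K U(1)] fixed_points_coset_gset[OF H U(1)])
      have u: "u \<in> carrier G"
        using U by auto
      (* u fixes (aK, bH); translating by the inverse of a moves this point to (K, gH). *)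
      let ?x = "inv a \<otimes> u \<otimes> a" and ?g = "inv a \<otimes> b"
      have "a \<otimes> (inv a \<otimes> w) = w" if "w \<in> carrier G" for w
        using that a(1) by (simp flip: m_assoc)
      then have "inv ?g \<otimes> ?x \<otimes> ?g = inv b \<otimes> u \<otimes> b"
        using a(1) b(1) u by (simp add: inv_mult_group m_assoc)
      then have "?x \<in> K \<inter> (?g <# H #> inv ?g)"
        using mem_conjugate_iff[OF H_sub, of ?g ?x] a b u by simp
      then have "?x = \<one>"
        using R a(1) b(1) by auto
      then have "u = \<one>"
        using conjugation_is_surj[OF a(1) u] a(1) by simp
      then show False
        using U(3) by simp
    qed
    have P: "finite (fst ?P)" "group_action G (fst ?P) (snd ?P)"
      and Z: "finite (fst ?Z)" "group_action G (fst ?Z) (snd ?Z)"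
      using finite_gset_gset_prod[OF gsets(1,2)] gsets(3) by (auto simp: finite_gset_def)
    let ?k = "card (orbits G (fst ?P) (snd ?P))"
    have P_ne: "fst ?P \<noteq> {}"
      by (auto simp: gset_prod_def coset_gset_def LCOSETS_def)
    have card_P: "card (fst ?P) = ?k * order G"
    proof (rule group_action.card_free_action[OF P(2) fin P(1)])
      fix g assume "g \<in> carrier G" "g \<noteq> \<one>"
      then have "mark ?P {g} = 0"
        using no_fixed[of "{g}" g] by simp
      then show "fixed_points (fst ?P) (snd ?P) {g} = {}"
        using P(1) by (auto simp: fixed_points_def)
    qed
    have card_Z: "card (fst ?Z) = order G"
      using l_lagrange[OF fin triv_subgroup] by (simp add: coset_gset_def)
    (* The product is not empty, so there is at least one orbit. *)
    have "?k * order G \<noteq> 0"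
      using P_ne P(1) unfolding card_P[symmetric] by simp
    then have "?k > 0"
      by (metis mult_is_0 neq0_conv)
    moreover have "mark ?P U = ?k * mark ?Z U" if U: "U \<subseteq> carrier G" for U
    proof (cases "\<exists>u \<in> U. u \<noteq> \<one>")
      case True
      then show ?thesis
        using no_fixed mark_coset_gset_regular U by auto
    next
      case False
      (* U contains at most the identity and fixes every point. *)
      then have "fixed_points (fst ?P) (snd ?P) U = fst ?P"
        "fixed_points (fst ?Z) (snd ?Z) U = fst ?Z"
        using group_action.id_eq_one[OF P(2), symmetric] group_action.id_eq_one[OF Z(2), symmetric]
        by (auto simp: fixed_points_def)
      then show ?thesis
        using card_P card_Z by simp
    qed
    ultimately show ?L
      using L by blast
  qed
qed

section \<open>Dominating sets of the intersection graph\<close>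

text \<open>With a relation that is reflexive on the vertices, members of a dominating set need no
  separate treatment. This is the situation below, since a vertex \<open>K\<close> satisfies \<open>K \<inter> K = K \<noteq> 1\<close>.\<close>

lemma dominates_reflexive_iff:
  assumes "\<And>v. v \<in> V \<Longrightarrow> R v v" "D \<subseteq> V"
  shows "(\<forall>v \<in> V - D. \<exists>d \<in> D. v \<in> V \<and> d \<in> V \<and> v \<noteq> d \<and> R v d) \<longleftrightarrow> (\<forall>v \<in> V. \<exists>d \<in> D. R v d)"
  using assms by blast

lemma dominating_set_intersection_graph_iff:
  "dominating_set (intersection_graph G) D \<longleftrightarrow>
     D \<subseteq> proper_nontrivial_subgroups G \<and>
     (\<forall>K \<in> proper_nontrivial_subgroups G. \<exists>H \<in> D. K \<inter> H \<noteq> {\<one>\<^bsub>G\<^esub>})"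
proof -
  let ?V = "proper_nontrivial_subgroups G"
  have self: "K \<inter> K \<noteq> {\<one>\<^bsub>G\<^esub>}" if "K \<in> ?V" for K
    using that by (simp add: proper_nontrivial_subgroups_def)
  have "dominating_set (intersection_graph G) D \<longleftrightarrow> D \<subseteq> ?V \<and>
      (\<forall>K \<in> ?V - D. \<exists>H \<in> D. K \<in> ?V \<and> H \<in> ?V \<and> K \<noteq> H \<and> K \<inter> H \<noteq> {\<one>\<^bsub>G\<^esub>})"
    by (simp add: dominating_set_def intersection_graph_def)
  also have "\<dots> \<longleftrightarrow> D \<subseteq> ?V \<and> (\<forall>K \<in> ?V. \<exists>H \<in> D. K \<inter> H \<noteq> {\<one>\<^bsub>G\<^esub>})"
    by (rule conj_cong[OF refl dominates_reflexive_iff[where R = "\<lambda>K H. K \<inter> H \<noteq> {\<one>\<^bsub>G\<^esub>}"]])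
      (use self in auto)
  finally show ?thesis .
qed

lemma domination_number_le:
  assumes "dominating_set (intersection_graph G) D" "proper_nontrivial_subgroups G \<noteq> {}"
  shows "domination_number G \<le> ecard D"
  using assms by (auto simp: domination_number_def intro: INF_lower)

lemma domination_number_eq_1_iff:
  "domination_number G = 1 \<longleftrightarrow>
     (\<exists>H \<in> proper_nontrivial_subgroups G.
        \<forall>K \<in> proper_nontrivial_subgroups G. K \<inter> H \<noteq> {\<one>\<^bsub>G\<^esub>})"
proof
  let ?V = "proper_nontrivial_subgroups G" and ?\<D> = "{D. dominating_set (intersection_graph G) D}"
  assume 1: "domination_number G = 1"
  then have Inf: "Inf (ecard ` ?\<D>) = 1"
    by (auto simp: domination_number_def split: if_splits)
  then have "ecard ` ?\<D> \<noteq> {}"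
    unfolding Inf_enat_def by (metis enat_ord_simps(4) one_enat_def enat.distinct(2))
  (* The order on enat is a well-order, so the infimum is attained. *)
  then have "Inf (ecard ` ?\<D>) \<in> ecard ` ?\<D>"
    unfolding Inf_enat_def by (metis (mono_tags) LeastI_ex ex_in_conv)
  then obtain D where D: "D \<in> ?\<D>" "ecard D = 1"
    using Inf by auto
  then have "card D = 1"
    by (auto simp: ecard_def one_enat_def split: if_splits)
  then obtain H where "D = {H}"
    by (auto simp: card_1_singleton_iff)
  then show "\<exists>H \<in> ?V. \<forall>K \<in> ?V. K \<inter> H \<noteq> {\<one>\<^bsub>G\<^esub>}"
    using D(1) by (auto simp: dominating_set_intersection_graph_iff)
next
  let ?V = "proper_nontrivial_subgroups G"
  assume "\<exists>H \<in> ?V. \<forall>K \<in> ?V. K \<inter> H \<noteq> {\<one>\<^bsub>G\<^esub>}"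
  then obtain H where H: "H \<in> ?V" "\<forall>K \<in> ?V. K \<inter> H \<noteq> {\<one>\<^bsub>G\<^esub>}"
    by auto
  have "dominating_set (intersection_graph G) {H}"
    using H by (simp add: dominating_set_intersection_graph_iff)
  then have "domination_number G \<le> ecard {H}"
    using H(1) by (intro domination_number_le) auto
  moreover have "1 \<le> ecard D" if "dominating_set (intersection_graph G) D" for D
  proof -
    have "D \<noteq> {}"
      using that H(1) by (auto simp: dominating_set_intersection_graph_iff)
    then show ?thesis
      by (auto simp: ecard_def one_enat_def Suc_le_eq card_gt_0_iff)
  qed
  then have "1 \<le> domination_number G"
    by (auto simp: domination_number_def intro!: INF_greatest)
  ultimately show "domination_number G = 1"
    by (simp add: ecard_def one_enat_def)
qed

lemma (in group) conjugate_eq_if_normal: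
  assumes "H \<lhd> G" "g \<in> carrier G"
  shows "g <# H #> inv g = H"
proof -
  have H: "H \<subseteq> carrier G"
    using assms(1) by (intro subgroup.subset normal_imp_subgroup)
  have "g <# H #> inv g = H #> g #> inv g"
    using normal.coset_eq[OF assms(1)] assms(2) by simp
  then show ?thesis
    using H assms(2) by (simp add: coset_mult_assoc)
qed

lemma (in group) conjugate_proper_nontrivial:
  assumes "H \<in> proper_nontrivial_subgroups G" "g \<in> carrier G"
  shows "g <# H #> inv g \<in> proper_nontrivial_subgroups G"
proof -
  have H: "subgroup H G" "H \<noteq> {\<one>}" "H \<noteq> carrier G"
    using assms(1) by (auto simp: proper_nontrivial_subgroups_def)
  note H_sub = subgroup.subset[OF H(1)]
  have fixed: "g <# N #> inv g = N" if "N = {\<one>} \<or> N = carrier G" for N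
    using that conjugate_eq_if_normal[OF one_is_normal assms(2)]
      mem_conjugate_iff[OF subset_refl assms(2)] assms(2) by auto
  have "g <# H #> inv g \<noteq> N" if N: "N = {\<one>} \<or> N = carrier G" for N
  proof
    assume "g <# H #> inv g = N"
    then have "g <# H #> inv g = g <# N #> inv g"
      by (simp only: fixed[OF N])
    moreover have "N \<subseteq> carrier G"
      using N by auto
    ultimately have "H = N"
      by (intro subgroup_conjugation_is_inj[OF assms(2) H_sub])
    then show False
      using H N by simp
  qed
  then have "g <# H #> inv g \<noteq> {\<one>}" "g <# H #> inv g \<noteq> carrier G"
    by simp_all
  then show ?thesis
    using subgroup_conjugation_is_surj2[OF assms(2) H(1)]
    by (simp add: proper_nontrivial_subgroups_def)
qed

text \<open>The normalizer is the stabilizer of \<open>H\<close> under conjugation of subsets.\<close>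

lemma (in group) card_conjugates:
  assumes "finite (carrier G)" "H \<subseteq> carrier G"
  shows "card ((\<lambda>g. g <# H #> inv g) ` carrier G) = card (rcosets (normalizer G H))"
proof -
  let ?\<phi> = "\<lambda>g. \<lambda>H \<in> {H. H \<subseteq> carrier G}. g <# H #> inv g"
  have "orbit G ?\<phi> H = (\<lambda>g. g <# H #> inv g) ` carrier G"
    using assms(2) by (auto simp: orbit_def)
  then have "card ((\<lambda>g. g <# H #> inv g) ` carrier G) * card (normalizer G H) = order G"
    using group_action.orbit_stabilizer_theorem[OF action_by_conjugation_on_power_set, of H] assms(2)
    by (simp add: normalizer_def)
  moreover have "card (rcosets (normalizer G H)) * card (normalizer G H) = order G"
    using lagrange[OF normalizer_imp_subgroup[OF assms(2)]] .
  moreover have "card (normalizer G H) > 0"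
    using subgroup.finite_imp_card_positive[OF normalizer_imp_subgroup[OF assms(2)] assms(1)] .
  ultimately have "card (normalizer G H) > 0"
    "card ((\<lambda>g. g <# H #> inv g) ` carrier G) * card (normalizer G H)
      = card (rcosets (normalizer G H)) * card (normalizer G H)"
    by (simp_all only:)
  then show ?thesis
    by simp
qed

text \<open>The normal core of a dominating subgroup \<open>H\<close> still dominates. Inside \<open>K\<close> there is a minimal
  non-trivial subgroup \<open>M\<close>. It meets every conjugate of \<open>H\<close> non-trivially, since each conjugate of
  \<open>M\<close> is a vertex and so meets \<open>H\<close>. By minimality \<open>M\<close> lies in all these conjugates.\<close>

lemma (in group) normal_core_of_dominating_subgroup:
  assumes fin: "finite (carrier G)"
    and H: "H \<in> proper_nontrivial_subgroups G"
    and dom: "\<forall>K \<in> proper_nontrivial_subgroups G. K \<inter> H \<noteq> {\<one>}"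
  shows "\<exists>N. N \<lhd> G \<and> N \<in> proper_nontrivial_subgroups G \<and>
    (\<forall>K \<in> proper_nontrivial_subgroups G. K \<inter> N \<noteq> {\<one>})"
proof -
  have sub: "subgroup H G" "H \<noteq> carrier G"
    using H by (auto simp: proper_nontrivial_subgroups_def)
  note H_sub = subgroup.subset[OF sub(1)]
  define N where "N = (\<Inter>g \<in> carrier G. g <# H #> inv g)"
  have N_iff: "x \<in> N \<longleftrightarrow> x \<in> carrier G \<and> (\<forall>g \<in> carrier G. inv g \<otimes> x \<otimes> g \<in> H)" for x
  proof -
    have "x \<in> N \<longleftrightarrow> (\<forall>g \<in> carrier G. x \<in> g <# H #> inv g)"
      by (simp add: N_def)
    also have "\<dots> \<longleftrightarrow> (\<forall>g \<in> carrier G. x \<in> carrier G \<and> inv g \<otimes> x \<otimes> g \<in> H)"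
      by (rule ball_cong[OF refl mem_conjugate_iff[OF H_sub]])
    also have "\<dots> \<longleftrightarrow> x \<in> carrier G \<and> (\<forall>g \<in> carrier G. inv g \<otimes> x \<otimes> g \<in> H)"
      using one_closed by meson
    finally show ?thesis .
  qed
  have N: "subgroup N G"
    unfolding N_def
    by (rule subgroups_Inter) (use subgroup_conjugation_is_surj2[OF _ sub(1)] in auto)
  have normal: "N \<lhd> G"
    unfolding normal_inv_iff
  proof (intro conjI ballI N)
    fix a x assume a: "a \<in> carrier G" and x: "x \<in> N"
    have xG: "x \<in> carrier G"
      using x by (simp add: N_iff)
    have "inv g \<otimes> (a \<otimes> x \<otimes> inv a) \<otimes> g \<in> H" if g: "g \<in> carrier G" for g
    proof -
      have "inv g \<otimes> (a \<otimes> x \<otimes> inv a) \<otimes> g = inv (inv a \<otimes> g) \<otimes> x \<otimes> (inv a \<otimes> g)"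
        using a xG g by (simp add: inv_mult_group m_assoc)
      then show ?thesis
        using x a g by (simp add: N_iff)
    qed
    then show "a \<otimes> x \<otimes> inv a \<in> N"
      using a xG by (simp add: N_iff)
  qed
  have "N \<subseteq> H"
    using N_iff one_closed by force
  have meets: "K \<inter> N \<noteq> {\<one>}" if K: "K \<in> proper_nontrivial_subgroups G" for K
  proof -
    let ?S = "{L. subgroup L G \<and> L \<noteq> {\<one>} \<and> L \<subseteq> K}"
    have K': "subgroup K G" "K \<noteq> {\<one>}" "K \<noteq> carrier G"
      using K by (auto simp: proper_nontrivial_subgroups_def)
    have "finite ?S"
      by (rule finite_subset[of _ "Pow (carrier G)"]) (use fin in \<open>auto dest: subgroup.subset\<close>)
    moreover have "K \<in> ?S"
      using K' by simp
    ultimately have "\<exists>M \<in> ?S. \<forall>L \<in> ?S. L \<subseteq> M \<longrightarrow> M = L"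
      by (intro finite_has_minimal) blast+
    then obtain M where "M \<in> ?S" and minimal: "\<forall>L \<in> ?S. L \<subseteq> M \<longrightarrow> M = L"
      by (rule bexE)
    then have M: "subgroup M G" "M \<noteq> {\<one>}" "M \<subseteq> K"
      by auto
    have "M \<noteq> carrier G"
      using M(3) K'(3) subgroup.subset[OF K'(1)] by auto
    then have MV: "M \<in> proper_nontrivial_subgroups G"
      using M by (simp add: proper_nontrivial_subgroups_def)
    note M_sub = subgroup.subset[OF M(1)]
    (* y = gxg\<inverse> for a non-trivial x in g\<inverse>Mg and H lies in M and in the conjugate of H. *)
    have "M \<subseteq> g <# H #> inv g" if g: "g \<in> carrier G" for g
    proof -
      note mem = mem_conjugate_iff[OF M_sub inv_closed[OF g], unfolded inv_inv[OF g]]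
      have "(inv g <# M #> g) \<inter> H \<noteq> {\<one>}"
        using bspec[OF dom conjugate_proper_nontrivial[OF MV inv_closed[OF g]]]
        unfolding inv_inv[OF g] .
      moreover have "\<one> \<in> (inv g <# M #> g) \<inter> H"
        using g M(1) sub(1) by (simp add: mem subgroup.one_closed)
      ultimately obtain x where x: "x \<in> inv g <# M #> g" "x \<in> H" "x \<noteq> \<one>"
        by auto
      let ?y = "g \<otimes> x \<otimes> inv g"
      have xG: "x \<in> carrier G" and "?y \<in> M"
        using x(1) by (simp_all add: mem)
      moreover have conj_y: "inv g \<otimes> ?y \<otimes> g = x"
        using conjugation_is_surj[of "inv g" x] g xG by simp
      then have "?y \<in> g <# H #> inv g"
        using x(2) g xG by (simp add: mem_conjugate_iff[OF H_sub])
      moreover have "?y \<noteq> \<one>"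
        using conj_y x(3) g by auto
      ultimately have "M \<inter> (g <# H #> inv g) \<noteq> {\<one>}"
        by auto
      then have "M \<inter> (g <# H #> inv g) \<in> ?S"
        using subgroups_Inter_pair[OF M(1) subgroup_conjugation_is_surj2[OF g sub(1)]] M(3) by auto
      then have "M = M \<inter> (g <# H #> inv g)"
        by (rule minimal[rule_format, OF _ Int_lower1])
      then show ?thesis
        by (simp only: le_iff_inf)
    qed
    then have "M \<subseteq> K \<inter> N"
      using M(3) by (auto simp: N_def)
    then show ?thesis
      using M(2) subgroup.one_closed[OF M(1)] by auto
  qed
  have "N \<noteq> {\<one>}"
    using meets[OF H] \<open>N \<subseteq> H\<close> by (auto simp: Int_absorb1)
  moreover have "N \<noteq> carrier G"
    using \<open>N \<subseteq> H\<close> sub(2) H_sub by auto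
  ultimately have "N \<in> proper_nontrivial_subgroups G"
    using N by (simp add: proper_nontrivial_subgroups_def)
  then show ?thesis
    using normal meets by meson
qed

section \<open>The domination number and the Burnside ring\<close>

text \<open>The conjugates of all \<open>H i\<close> together form a dominating set, and \<open>H i\<close> has as many
  conjugates as its normalizer has cosets.\<close>

theorem (in group) domination_number_le_sum_index_normalizer:
  fixes H :: "nat \<Rightarrow> 'a set"
  assumes fin: "finite (carrier G)" and s: "s \<ge> 1"
    and HV: "\<forall>i \<in> {1..s}. H i \<in> proper_nontrivial_subgroups G"
    and not_multiple: "\<forall>K \<in> proper_nontrivial_subgroups G. \<exists>i \<in> {1..s}. \<forall>k :: nat. k > 0 \<longrightarrow>
        burnside_class G (coset_gset G K) \<otimes>\<^bsub>burnside_ring G\<^esub> burnside_class G (coset_gset G (H i))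
          \<noteq> [k] \<cdot>\<^bsub>burnside_ring G\<^esub> burnside_class G (coset_gset G {\<one>})"
  shows "domination_number G \<le> enat (\<Sum>i = 1..s. card (rcosets (normalizer G (H i))))"
proof -
  let ?V = "proper_nontrivial_subgroups G"
  let ?conj = "\<lambda>i. (\<lambda>g. g <# H i #> inv g) ` carrier G"
  let ?D = "\<Union>i \<in> {1..s}. ?conj i"
  have H: "subgroup (H i) G" if "i \<in> {1..s}" for i
    using HV that by (simp add: proper_nontrivial_subgroups_def)
  have "\<exists>L \<in> ?D. K \<inter> L \<noteq> {\<one>}" if K: "K \<in> ?V" for K
  proof -
    have K': "subgroup K G"
      using K by (simp add: proper_nontrivial_subgroups_def)
    obtain i where i: "i \<in> {1..s}" and "\<forall>k :: nat. k > 0 \<longrightarrow>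
        burnside_class G (coset_gset G K) \<otimes>\<^bsub>burnside_ring G\<^esub> burnside_class G (coset_gset G (H i))
          \<noteq> [k] \<cdot>\<^bsub>burnside_ring G\<^esub> burnside_class G (coset_gset G {\<one>})"
      using not_multiple K by meson
    then obtain g where "g \<in> carrier G" "K \<inter> (g <# H i #> inv g) \<noteq> {\<one>}"
      using coset_product_multiple_of_regular_iff[OF fin K' H[OF i]] by meson
    then show ?thesis
      using i by blast
  qed
  moreover have "?D \<subseteq> ?V"
    using HV conjugate_proper_nontrivial by blast
  ultimately have "dominating_set (intersection_graph G) ?D"
    unfolding dominating_set_intersection_graph_iff by meson
  moreover have "?V \<noteq> {}"
    using HV s by force
  ultimately have "domination_number G \<le> ecard ?D"
    by (rule domination_number_le)
  also have "ecard ?D = enat (card ?D)"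
    using fin by (simp add: ecard_def)
  also have "card ?D \<le> (\<Sum>i = 1..s. card (?conj i))"
    by (rule card_UN_le) simp
  also have "(\<Sum>i = 1..s. card (?conj i)) = (\<Sum>i = 1..s. card (rcosets (normalizer G (H i))))"
    by (intro sum.cong card_conjugates[OF fin subgroup.subset[OF H]] refl)
  finally show ?thesis
    by simp
qed

theorem (in group) domination_number_eq_1_iff_normal_coset_product:
  assumes fin: "finite (carrier G)"
  shows "domination_number G = 1 \<longleftrightarrow>
    (\<exists>H. H \<lhd> G \<and> H \<noteq> {\<one>} \<and> H \<noteq> carrier G \<and>
      (\<forall>K \<in> proper_nontrivial_subgroups G. \<forall>k :: nat. k > 0 \<longrightarrow>
        burnside_class G (coset_gset G K) \<otimes>\<^bsub>burnside_ring G\<^esub> burnside_class G (coset_gset G (H))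
          \<noteq> [k] \<cdot>\<^bsub>burnside_ring G\<^esub> burnside_class G (coset_gset G {\<one>})))"
proof -
  let ?V = "proper_nontrivial_subgroups G"
  have meets_iff: "(\<forall>K \<in> ?V. \<forall>k :: nat. k > 0 \<longrightarrow>
        burnside_class G (coset_gset G K) \<otimes>\<^bsub>burnside_ring G\<^esub> burnside_class G (coset_gset G (H))
          \<noteq> [k] \<cdot>\<^bsub>burnside_ring G\<^esub> burnside_class G (coset_gset G {\<one>}))
      \<longleftrightarrow> (\<forall>K \<in> ?V. K \<inter> H \<noteq> {\<one>})" if H: "H \<lhd> G" for H
  proof (rule ball_cong[OF refl])
    fix K assume "K \<in> ?V"
    then have K: "subgroup K G"
      by (simp add: proper_nontrivial_subgroups_def)
    have "(\<forall>g \<in> carrier G. K \<inter> (g <# H #> inv g) = {\<one>}) \<longleftrightarrow> K \<inter> H = {\<one>}"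
      using conjugate_eq_if_normal[OF H] one_closed by auto
    then show "(\<forall>k :: nat. k > 0 \<longrightarrow>
        burnside_class G (coset_gset G K) \<otimes>\<^bsub>burnside_ring G\<^esub> burnside_class G (coset_gset G (H))
          \<noteq> [k] \<cdot>\<^bsub>burnside_ring G\<^esub> burnside_class G (coset_gset G {\<one>}))
      \<longleftrightarrow> K \<inter> H \<noteq> {\<one>}"
      using coset_product_multiple_of_regular_iff[OF fin K normal_imp_subgroup[OF H]] by meson
  qed
  have vertex_iff: "H \<in> ?V \<longleftrightarrow> H \<noteq> {\<one>} \<and> H \<noteq> carrier G" if "H \<lhd> G" for H
    using normal_imp_subgroup[OF that] by (simp add: proper_nontrivial_subgroups_def)
  have "domination_number G = 1 \<longleftrightarrow> (\<exists>H \<in> ?V. \<forall>K \<in> ?V. K \<inter> H \<noteq> {\<one>})"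
    by (rule domination_number_eq_1_iff)
  also have "\<dots> \<longleftrightarrow> (\<exists>H. H \<lhd> G \<and> H \<in> ?V \<and> (\<forall>K \<in> ?V. K \<inter> H \<noteq> {\<one>}))"
    using normal_core_of_dominating_subgroup[OF fin] by meson
  also have "\<dots> \<longleftrightarrow> (\<exists>H. H \<lhd> G \<and> H \<noteq> {\<one>} \<and> H \<noteq> carrier G \<and> (\<forall>K \<in> ?V. K \<inter> H \<noteq> {\<one>}))"
    using vertex_iff by meson
  finally show ?thesis
    using meets_iff by (simp only: cong: conj_cong)
qed

theorem proposition6p2:
  fixes G :: "('a, 'b) monoid_scheme"
  assumes "group G" and "finite (carrier G)"
  shows "(\<forall>(s :: nat) (H :: nat \<Rightarrow> 'a set).
            s \<ge> 1 \<longrightarrow>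
            (\<forall>i \<in> {1..s}. H i \<in> proper_nontrivial_subgroups G) \<longrightarrow>
            (\<forall>K \<in> proper_nontrivial_subgroups G. \<exists>i \<in> {1..s}. \<forall>k :: nat. k > 0 \<longrightarrow>
               burnside_class G (coset_gset G K) \<otimes>\<^bsub>burnside_ring G\<^esub> burnside_class G (coset_gset G (H i))
                 \<noteq> [k] \<cdot>\<^bsub>burnside_ring G\<^esub> burnside_class G (coset_gset G {\<one>\<^bsub>G\<^esub>})) \<longrightarrow>
            domination_number G \<le> enat (\<Sum>i = 1..s. card (rcosets\<^bsub>G\<^esub> (normalizer G (H i)))))
       \<and> (domination_number G = 1 \<longleftrightarrow>
            (\<exists>H. H \<lhd> G \<and> H \<noteq> {\<one>\<^bsub>G\<^esub>} \<and> H \<noteq> carrier G \<and>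
               (\<forall>K \<in> proper_nontrivial_subgroups G. \<forall>k :: nat. k > 0 \<longrightarrow>
                  burnside_class G (coset_gset G K) \<otimes>\<^bsub>burnside_ring G\<^esub> burnside_class G (coset_gset G H)
                    \<noteq> [k] \<cdot>\<^bsub>burnside_ring G\<^esub> burnside_class G (coset_gset G {\<one>\<^bsub>G\<^esub>}))))"
proof -
  interpret group G
    by fact
  show ?thesis
    by (intro conjI allI impI domination_number_le_sum_index_normalizer[OF assms(2)]
        domination_number_eq_1_iff_normal_coset_product[OF assms(2)]; assumption)
qed

end
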